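(* Let $m\ne 0$ be a measure on an unbounded pseudo-BCK algebra $A$ that is downwards-directed. Then $m$ is a measure-morphism if and only if $\mathrm{Ker}_0(m)$ is a maximal filter of $A$.
   Context: A pseudo-BCK algebra is a structure $(A,\le,\rightarrow,\rightsquigarrow,1)$ with $\le$ a binary relation, $\rightarrow,\rightsquigarrow$ binary operations and $1\in A$, such that for all $x,y,z\in A$: $x\rightarrow y\le (y\rightarrow z)\rightsquigarrow(x\rightarrow z)$ and $x\rightsquigarrow y\le (y\rightsquigarrow z)\rightarrow(x\rightsquigarrow z)$; $x\le (x\rightarrow y)\rightsquigarrow y$ and $x\le (x\rightsquigarrow y)\rightarrow y$; $x\le x$; $x\le 1$; antisymmetry of $\le$; $x\le y$ iff $x\rightarrow y=1$ iff $x\rightsquigarrow y=1$. It is unbounded if it has no least element; downwards-directed if any two elements have a common lower bound. A measure is a map $m:A\to[0,\infty)$ with $m(x\rightarrow y)=m(x\rightsquigarrow y)=m(y)-m(x)$ whenever $y\le x$; a measure-morphism is a map $m:A\to[0,\infty)$ with $m(x\rightarrow y)=m(x\rightsquigarrow y)=\max\{0,m(y)-m(x)\}$ for all $x,y$. $\mathrm{Ker}_0(m)=\{x: m(x)=0\}$. A filter is a set $F\ni 1$ with $a,a\rightarrow b\in F\Rightarrow b\in F$; it is maximal if it is a proper subset of $A$ and not properly contained in another proper filter. *)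

theory Defs
  imports Complex_Main
begin

text \<open>
  The universe of a pseudo-BCK algebra is the type \<open>'a\<close>; the two implications
  are written \<open>\<^bold>\<rightarrow>\<close> and \<open>\<^bold>\<leadsto>\<close> below. All maps into the half-line of
  nonnegative reals are real-valued functions carrying an explicit nonnegativity clause.
\<close>

locale pseudo_bck_algebra =
  fixes le :: "'a \<Rightarrow> 'a \<Rightarrow> bool" (infix "\<preceq>" 50)
    and limp :: "'a \<Rightarrow> 'a \<Rightarrow> 'a" (infixr "\<^bold>\<rightarrow>" 60)
    and rimp :: "'a \<Rightarrow> 'a \<Rightarrow> 'a" (infixr "\<^bold>\<leadsto>" 60)
    and one :: "'a" ("\<^bold>1")
  assumes limp_trans: "x \<^bold>\<rightarrow> y \<preceq> (y \<^bold>\<rightarrow> z) \<^bold>\<leadsto> (x \<^bold>\<rightarrow> z)"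
    and rimp_trans: "x \<^bold>\<leadsto> y \<preceq> (y \<^bold>\<leadsto> z) \<^bold>\<rightarrow> (x \<^bold>\<leadsto> z)"
    and le_limp_rimp: "x \<preceq> (x \<^bold>\<rightarrow> y) \<^bold>\<leadsto> y"
    and le_rimp_limp: "x \<preceq> (x \<^bold>\<leadsto> y) \<^bold>\<rightarrow> y"
    and le_refl: "x \<preceq> x"
    and le_one: "x \<preceq> \<^bold>1"
    and le_antisym: "x \<preceq> y \<Longrightarrow> y \<preceq> x \<Longrightarrow> x = y"
    and le_iff_limp: "x \<preceq> y \<longleftrightarrow> x \<^bold>\<rightarrow> y = \<^bold>1"
    and le_iff_rimp: "x \<preceq> y \<longleftrightarrow> x \<^bold>\<leadsto> y = \<^bold>1"

definition unbounded_below :: "('a \<Rightarrow> 'a \<Rightarrow> bool) \<Rightarrow> bool" where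
  "unbounded_below le \<longleftrightarrow> \<not> (\<exists>b. \<forall>x. le b x)"

definition downwards_directed :: "('a \<Rightarrow> 'a \<Rightarrow> bool) \<Rightarrow> bool" where
  "downwards_directed le \<longleftrightarrow> (\<forall>x y. \<exists>z. le z x \<and> le z y)"

definition bck_measure ::
  "('a \<Rightarrow> 'a \<Rightarrow> bool) \<Rightarrow> ('a \<Rightarrow> 'a \<Rightarrow> 'a) \<Rightarrow> ('a \<Rightarrow> 'a \<Rightarrow> 'a) \<Rightarrow> ('a \<Rightarrow> real) \<Rightarrow> bool" where
  "bck_measure le limp rimp m \<longleftrightarrow>
     (\<forall>x. 0 \<le> m x) \<and>
     (\<forall>x y. le y x \<longrightarrow> m (limp x y) = m y - m x \<and> m (rimp x y) = m y - m x)"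

definition measure_morphism ::
  "('a \<Rightarrow> 'a \<Rightarrow> 'a) \<Rightarrow> ('a \<Rightarrow> 'a \<Rightarrow> 'a) \<Rightarrow> ('a \<Rightarrow> real) \<Rightarrow> bool" where
  "measure_morphism limp rimp m \<longleftrightarrow>
     (\<forall>x. 0 \<le> m x) \<and>
     (\<forall>x y. m (limp x y) = max 0 (m y - m x) \<and> m (rimp x y) = max 0 (m y - m x))"

definition Ker0 :: "('a \<Rightarrow> real) \<Rightarrow> 'a set" where
  "Ker0 m = {x. m x = 0}"

definition bck_filter :: "('a \<Rightarrow> 'a \<Rightarrow> 'a) \<Rightarrow> 'a \<Rightarrow> 'a set \<Rightarrow> bool" where
  "bck_filter limp one F \<longleftrightarrow> one \<in> F \<and> (\<forall>a b. a \<in> F \<longrightarrow> limp a b \<in> F \<longrightarrow> b \<in> F)"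

definition maximal_bck_filter :: "('a \<Rightarrow> 'a \<Rightarrow> 'a) \<Rightarrow> 'a \<Rightarrow> 'a set \<Rightarrow> bool" where
  "maximal_bck_filter limp one F \<longleftrightarrow>
     bck_filter limp one F \<and> F \<noteq> UNIV \<and>
     \<not> (\<exists>G. bck_filter limp one G \<and> G \<noteq> UNIV \<and> F \<subset> G)"

end

theory Submission
  imports Defs
begin

text \<open>
  If \<open>m\<close> is a morphism, then for \<open>a\<close> outside the kernel the iterates \<open>a \<rightarrow> (\<dots> \<rightarrow> (a \<rightarrow> b))\<close> have
  measure \<open>max 0 (m b - n * m a)\<close>, so they reach the kernel, and every filter above the kernel that
  contains \<open>a\<close> contains all \<open>b\<close>.

  Conversely, \<open>x \<squnion> y = (x \<rightarrow> y) \<leadsto> y\<close> has the largest measure among the common upper bounds of \<open>x\<close>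
  and \<open>y\<close>, and \<open>m (x \<rightarrow> y) = m y - m (x \<squnion> y)\<close>; so \<open>m\<close> is a morphism as soon as
  \<open>m (x \<squnion> y) = min (m x) (m y)\<close>. A lower bound of \<open>x\<close> and \<open>y\<close> yields, up to null elements, a meet
  of \<open>x\<close> and \<open>y\<close>, and from it prelinearity: common upper bounds of \<open>x \<rightarrow> y\<close> and \<open>y \<rightarrow> x\<close> are null.
  The polar of \<open>y \<rightarrow> x\<close>, consisting of all \<open>t\<close> such that every common upper bound of \<open>t\<close> and
  \<open>y \<rightarrow> x\<close> is null, is then a filter containing the kernel and \<open>x \<rightarrow> y\<close>. When the kernel is maximal,
  one of \<open>x \<rightarrow> y\<close> and \<open>y \<rightarrow> x\<close> must therefore be null.
\<close>

context pseudo_bck_algebra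
begin

lemma one_le_iff: "\<^bold>1 \<preceq> x \<longleftrightarrow> x = \<^bold>1"
  using le_antisym le_one by blast

lemma one_limp: "\<^bold>1 \<^bold>\<rightarrow> x = x"
proof (rule le_antisym)
  have "\<^bold>1 \<preceq> (\<^bold>1 \<^bold>\<rightarrow> x) \<^bold>\<leadsto> x" by (rule le_limp_rimp)
  then show "\<^bold>1 \<^bold>\<rightarrow> x \<preceq> x" unfolding one_le_iff le_iff_rimp[symmetric] .
  have "x \<^bold>\<leadsto> x = \<^bold>1" using le_refl by (simp only: le_iff_rimp)
  then show "x \<preceq> \<^bold>1 \<^bold>\<rightarrow> x" using le_rimp_limp[of x x] by simp
qed

lemma one_rimp: "\<^bold>1 \<^bold>\<leadsto> x = x"
proof (rule le_antisym)
  have "\<^bold>1 \<preceq> (\<^bold>1 \<^bold>\<leadsto> x) \<^bold>\<rightarrow> x" by (rule le_rimp_limp)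
  then show "\<^bold>1 \<^bold>\<leadsto> x \<preceq> x" unfolding one_le_iff le_iff_limp[symmetric] .
  have "x \<^bold>\<rightarrow> x = \<^bold>1" using le_refl by (simp only: le_iff_limp)
  then show "x \<preceq> \<^bold>1 \<^bold>\<leadsto> x" using le_limp_rimp[of x x] by simp
qed

lemma limp_antimono: "x \<preceq> y \<Longrightarrow> y \<^bold>\<rightarrow> z \<preceq> x \<^bold>\<rightarrow> z"
  by (metis le_iff_limp le_iff_rimp limp_trans one_le_iff)

lemma rimp_antimono: "x \<preceq> y \<Longrightarrow> y \<^bold>\<leadsto> z \<preceq> x \<^bold>\<leadsto> z"
  by (metis le_iff_limp le_iff_rimp rimp_trans one_le_iff)

lemma le_trans: "x \<preceq> y \<Longrightarrow> y \<preceq> z \<Longrightarrow> x \<preceq> z"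
  by (metis le_iff_limp limp_antimono one_le_iff)

lemma limp_mono: "y \<preceq> z \<Longrightarrow> x \<^bold>\<rightarrow> y \<preceq> x \<^bold>\<rightarrow> z"
  by (metis le_iff_limp limp_trans one_rimp)

lemma le_limp: "y \<preceq> x \<^bold>\<rightarrow> y"
  by (metis le_one limp_antimono one_limp)

lemma le_rimp: "y \<preceq> x \<^bold>\<leadsto> y"
  by (metis le_one rimp_antimono one_rimp)

lemma limp_rimp_limp: "((x \<^bold>\<rightarrow> y) \<^bold>\<leadsto> y) \<^bold>\<rightarrow> y = x \<^bold>\<rightarrow> y"
  by (rule le_antisym) (simp_all add: limp_antimono le_limp_rimp le_rimp_limp)

lemma rimp_limp_rimp: "((x \<^bold>\<leadsto> y) \<^bold>\<rightarrow> y) \<^bold>\<leadsto> y = x \<^bold>\<leadsto> y"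
  by (rule le_antisym) (simp_all add: rimp_antimono le_limp_rimp le_rimp_limp)

end

locale measured_pseudo_bck_algebra = pseudo_bck_algebra +
  fixes m :: "'a \<Rightarrow> real"
  assumes measure: "bck_measure le limp rimp m"
begin

text \<open>Not a supremum in general: only a common upper bound, whose measure alone is symmetric
  in \<open>x\<close> and \<open>y\<close>.\<close>

definition join :: "'a \<Rightarrow> 'a \<Rightarrow> 'a" (infixl "\<squnion>" 65) where
  "x \<squnion> y = (x \<^bold>\<rightarrow> y) \<^bold>\<leadsto> y"

lemma measure_nonneg: "0 \<le> m x"
  using measure by (simp add: bck_measure_def)

lemma measure_limp_le: "y \<preceq> x \<Longrightarrow> m (x \<^bold>\<rightarrow> y) = m y - m x"
  using measure by (simp add: bck_measure_def)

lemma measure_rimp_le: "y \<preceq> x \<Longrightarrow> m (x \<^bold>\<leadsto> y) = m y - m x"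
  using measure by (simp add: bck_measure_def)

lemma measure_antimono: "y \<preceq> x \<Longrightarrow> m x \<le> m y"
  using measure_limp_le[of y x] measure_nonneg[of "x \<^bold>\<rightarrow> y"] by simp

lemma measure_one: "m \<^bold>1 = 0"
  using measure_limp_le[OF le_refl] le_iff_limp le_refl by (metis diff_self)

lemma le_join1: "x \<preceq> x \<squnion> y"
  by (simp add: join_def le_limp_rimp)

lemma le_join2: "y \<preceq> x \<squnion> y"
  by (simp add: join_def le_rimp)

lemma measure_join_le: "y \<preceq> x \<Longrightarrow> m (x \<squnion> y) = m x"
  by (simp add: join_def measure_rimp_le le_limp measure_limp_le)

lemma measure_limp: "m (x \<^bold>\<rightarrow> y) = m y - m (x \<squnion> y)"
  using measure_limp_le[OF le_join2, of x y] by (simp add: join_def limp_rimp_limp)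

text \<open>Enlarging \<open>x\<close> to \<open>v\<close> enlarges the join with \<open>y\<close>,
  and \<open>v \<squnion> y\<close> has the measure of \<open>v\<close> because \<open>y\<close>
  lies below \<open>v\<close>.\<close>

lemma join_maximal_measure:
  assumes "x \<preceq> v" "y \<preceq> v"
  shows "m v \<le> m (x \<squnion> y)"
proof -
  have "x \<squnion> y \<preceq> v \<squnion> y"
    unfolding join_def using assms(1) by (intro rimp_antimono limp_antimono)
  then show ?thesis
    using measure_antimono measure_join_le[OF assms(2)] by fastforce
qed

lemma measure_rimp: "m (x \<^bold>\<leadsto> y) = m (x \<^bold>\<rightarrow> y)"
proof -
  define u where "u = (x \<^bold>\<leadsto> y) \<^bold>\<rightarrow> y"
  have ub: "x \<preceq> u" "y \<preceq> u"
    by (simp_all add: u_def le_rimp_limp le_limp)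
  \<comment> \<open>The mirrored maximality argument: the dual join \<open>u\<close> has at least
    the measure of the common upper bound \<open>x \<squnion> y\<close>.\<close>
  have "u \<preceq> ((x \<squnion> y) \<^bold>\<leadsto> y) \<^bold>\<rightarrow> y"
    unfolding u_def using le_join1 by (intro limp_antimono rimp_antimono)
  moreover have "m (((x \<squnion> y) \<^bold>\<leadsto> y) \<^bold>\<rightarrow> y) = m (x \<squnion> y)"
    by (simp add: measure_limp_le le_rimp measure_rimp_le le_join2)
  ultimately have "m (x \<squnion> y) \<le> m u"
    using measure_antimono by fastforce
  then have "m u = m (x \<squnion> y)"
    using join_maximal_measure[OF ub] by simp
  then show ?thesis
    using measure_rimp_le[OF ub(2)] by (simp add: u_def rimp_limp_rimp measure_limp)
qed

lemma measure_join_commute: "m (x \<squnion> y) = m (y \<squnion> x)"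
  by (simp add: antisym join_maximal_measure le_join1 le_join2)

lemma measure_morphism_iff:
  "measure_morphism limp rimp m \<longleftrightarrow> (\<forall>x y. m (x \<squnion> y) = min (m x) (m y))"
proof -
  have "m (x \<^bold>\<rightarrow> y) = max 0 (m y - m x) \<longleftrightarrow> m (x \<squnion> y) = min (m x) (m y)" for x y
    unfolding measure_limp by linarith
  then show ?thesis
    unfolding measure_morphism_def measure_rimp using measure_nonneg by blast
qed

lemma filter_Ker0: "bck_filter limp \<^bold>1 (Ker0 m)"
  unfolding bck_filter_def Ker0_def mem_Collect_eq
proof (intro conjI allI impI)
  fix a b assume "m a = 0" "m (a \<^bold>\<rightarrow> b) = 0"
  then show "m b = 0"
    using measure_limp[of a b] measure_antimono[OF le_join1, of a b] measure_nonneg[of "a \<squnion> b"]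
    by simp
qed (rule measure_one)

lemma maximal_filter_Ker0:
  assumes morphism: "measure_morphism limp rimp m" and nonzero: "m \<noteq> (\<lambda>_. 0)"
  shows "maximal_bck_filter limp \<^bold>1 (Ker0 m)"
  unfolding maximal_bck_filter_def
proof (intro conjI notI)
  show "bck_filter limp \<^bold>1 (Ker0 m)" by (rule filter_Ker0)
next
  assume "Ker0 m = UNIV"
  then show False using nonzero by (auto simp: Ker0_def)
next
  assume "\<exists>G. bck_filter limp \<^bold>1 G \<and> G \<noteq> UNIV \<and> Ker0 m \<subset> G"
  then obtain G a where G: "bck_filter limp \<^bold>1 G" "G \<noteq> UNIV" "Ker0 m \<subseteq> G"
    and a: "a \<in> G" "m a \<noteq> 0"
    by (auto simp: Ker0_def)
  have iterate: "m ((limp a ^^ n) b) = max 0 (m b - real n * m a)" for n b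
  proof (induction n)
    case 0
    then show ?case using measure_nonneg by simp
  next
    case (Suc n)
    have "m ((limp a ^^ Suc n) b) = max 0 (max 0 (m b - real n * m a) - m a)"
      using morphism Suc.IH by (simp add: measure_morphism_def)
    then show ?case
      using measure_nonneg[of a] by (simp add: algebra_simps max_def)
  qed
  have modus_ponens: "a \<^bold>\<rightarrow> c \<in> G \<Longrightarrow> c \<in> G" for c
    using G(1) a(1) unfolding bck_filter_def by blast
  have descend: "(limp a ^^ n) b \<in> G \<Longrightarrow> b \<in> G" for n b
    by (induction n) (simp_all add: modus_ponens)
  have "b \<in> G" for b
  proof -
    obtain n where "m b < real n * m a"
      using a(2) measure_nonneg[of a] reals_Archimedean3[of "m a"] by fastforce
    then have "(limp a ^^ n) b \<in> Ker0 m"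
      by (simp add: Ker0_def iterate)
    then show ?thesis using G(3) descend by blast
  qed
  then show False using G(2) by auto
qed

lemma filter_polar:
  "bck_filter limp \<^bold>1 {t. \<forall>c. t \<preceq> c \<longrightarrow> b \<preceq> c \<longrightarrow> m c = 0}" (is "bck_filter _ _ ?G")
  unfolding bck_filter_def
proof (intro conjI allI impI)
  show "\<^bold>1 \<in> ?G" by (auto simp: one_le_iff measure_one)
next
  fix t s assume t: "t \<in> ?G" and ts: "t \<^bold>\<rightarrow> s \<in> ?G"
  have "m c = 0" if c: "s \<preceq> c" "b \<preceq> c" for c
  proof -
    \<comment> \<open>\<open>m c\<close> is the sum of \<open>m (t \<rightarrow> c)\<close> and
      \<open>m (t \<squnion> c)\<close>. Both elements lie above \<open>b\<close>, the first also
      above \<open>t \<rightarrow> s\<close>, the second above \<open>t\<close>.\<close>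
    have "m (t \<^bold>\<rightarrow> c) = 0"
      using ts limp_mono[OF c(1)] le_trans[OF c(2) le_limp] by blast
    moreover have "m (t \<squnion> c) = 0"
      using t le_join1 le_trans[OF c(2) le_join2] by blast
    ultimately show ?thesis by (simp add: measure_limp)
  qed
  then show "s \<in> ?G" by blast
qed

text \<open>The bound on \<open>m w\<close> says that \<open>w\<close> is a meet of \<open>x\<close> and \<open>y\<close> up to null elements.\<close>

lemma prelinear:
  assumes w: "w \<preceq> x" "w \<preceq> y" "m w \<le> m x + m y - m (x \<squnion> y)"
    and c: "x \<^bold>\<rightarrow> y \<preceq> c" "y \<^bold>\<rightarrow> x \<preceq> c"
  shows "m c = 0"
proof -
  define q where "q = c \<^bold>\<leadsto> w"
  have wc: "x \<^bold>\<rightarrow> w \<preceq> c" "y \<^bold>\<rightarrow> w \<preceq> c"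
    using w c limp_mono le_trans by blast+
  have q: "q \<preceq> x \<squnion> w" "q \<preceq> y \<squnion> w"
    unfolding q_def join_def using wc by (auto intro: rimp_antimono)
  have "m q = m w - m c"
    unfolding q_def using wc le_limp le_trans by (blast intro: measure_rimp_le)
  \<comment> \<open>As a common lower bound of the two joins, \<open>q\<close> has measure at least
    \<open>m x + m y - m (x \<squnion> y)\<close>, hence at least \<open>m w\<close>; but
    \<open>m q = m w - m c\<close>.\<close>
  moreover have "m ((x \<squnion> w) \<^bold>\<rightarrow> (y \<squnion> w)) \<le> m q - m (x \<squnion> w)"
    using measure_antimono[OF limp_mono[OF q(2)]] measure_limp_le[OF q(1)] by metis
  moreover have "m ((x \<squnion> w) \<squnion> (y \<squnion> w)) \<le> m (x \<squnion> y)"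
    using le_trans le_join1 le_join2 by (blast intro: join_maximal_measure)
  ultimately show ?thesis
    using w measure_nonneg[of c] by (simp add: measure_limp measure_join_le)
qed

lemma measure_join_eq_min_of_meet:
  assumes maximal: "maximal_bck_filter limp \<^bold>1 (Ker0 m)"
    and w: "w \<preceq> x" "w \<preceq> y" "m w \<le> m x + m y - m (x \<squnion> y)"
  shows "m (x \<squnion> y) = min (m x) (m y)"
proof -
  define a where "a = x \<^bold>\<rightarrow> y"
  define b where "b = y \<^bold>\<rightarrow> x"
  define G where "G = {t. \<forall>c. t \<preceq> c \<longrightarrow> b \<preceq> c \<longrightarrow> m c = 0}"
  have "bck_filter limp \<^bold>1 G"
    unfolding G_def by (rule filter_polar)
  moreover have "Ker0 m \<subseteq> G"
  proof
    fix t assume t: "t \<in> Ker0 m"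
    have "m c = 0" if "t \<preceq> c" for c
      using t measure_antimono[OF that] measure_nonneg[of c] by (simp add: Ker0_def)
    then show "t \<in> G" by (simp add: G_def)
  qed
  moreover have "a \<in> G"
    unfolding G_def a_def b_def using prelinear[OF w] by blast
  \<comment> \<open>Maximality leaves \<open>G = Ker0 m\<close> or \<open>G = UNIV\<close>. In the
    second case \<open>c = b\<close> in the polar condition makes \<open>b\<close> null.\<close>
  ultimately have "a \<in> Ker0 m \<or> b \<in> G"
    using maximal unfolding maximal_bck_filter_def by blast
  then have "m a = 0 \<or> m b = 0"
    using le_refl by (auto simp: G_def Ker0_def)
  then have "m (x \<squnion> y) = m x \<or> m (x \<squnion> y) = m y"
    by (auto simp: a_def b_def measure_limp measure_join_commute[of y x])
  then show ?thesis
    using measure_antimono[OF le_join1, of x y] measure_antimono[OF le_join2, of x y] by auto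
qed

text \<open>
  Replacing \<open>x\<close> and \<open>y\<close> by \<open>x \<squnion> z\<close> and \<open>y \<squnion> z\<close>, which have the same measures, makes
  the de Morgan candidate \<open>w\<close> for the meet a genuine lower bound.
\<close>

lemma measure_join_eq_min:
  assumes maximal: "maximal_bck_filter limp \<^bold>1 (Ker0 m)"
    and z: "z \<preceq> x" "z \<preceq> y"
  shows "m (x \<squnion> y) = min (m x) (m y)"
proof -
  define p where "p = (x \<^bold>\<rightarrow> z) \<squnion> (y \<^bold>\<rightarrow> z)"
  define w where "w = p \<^bold>\<leadsto> z"
  have join: "m ((x \<squnion> z) \<squnion> (y \<squnion> z)) \<le> m (x \<squnion> y)"
    using le_trans le_join1 le_join2 by (blast intro: join_maximal_measure)
  have w: "w \<preceq> x \<squnion> z" "w \<preceq> y \<squnion> z"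
    unfolding w_def p_def join_def[of x z] join_def[of y z]
    by (intro rimp_antimono le_join1 le_join2)+
  have "m w = m z - m p"
    unfolding w_def p_def using le_limp le_join2 le_trans by (blast intro: measure_rimp_le)
  \<comment> \<open>This bounds \<open>m p\<close> from below and so \<open>m w\<close> from
    above.\<close>
  moreover have "m ((x \<^bold>\<rightarrow> z) \<^bold>\<rightarrow> (y \<^bold>\<rightarrow> z)) \<le> m (y \<^bold>\<rightarrow> x)"
    using measure_antimono[OF limp_trans] by (simp add: measure_rimp)
  ultimately have "m w \<le> m x + m y - m (x \<squnion> y)"
    using z by (simp add: measure_limp p_def measure_join_commute[of y x] measure_join_le)
  then have "m ((x \<squnion> z) \<squnion> (y \<squnion> z)) = min (m x) (m y)"
    using measure_join_eq_min_of_meet[OF maximal w] join z by (simp add: measure_join_le)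
  then show ?thesis
    using join measure_antimono[OF le_join1, of x y] measure_antimono[OF le_join2, of x y] by simp
qed

end

theorem theorem4p11:
  fixes le :: "'a \<Rightarrow> 'a \<Rightarrow> bool"
    and limp rimp :: "'a \<Rightarrow> 'a \<Rightarrow> 'a"
    and one :: 'a
    and m :: "'a \<Rightarrow> real"
  assumes "pseudo_bck_algebra le limp rimp one"
    and "unbounded_below le"
    and "downwards_directed le"
    and "bck_measure le limp rimp m"
    and "m \<noteq> (\<lambda>_. 0)"
  shows "measure_morphism limp rimp m \<longleftrightarrow> maximal_bck_filter limp one (Ker0 m)"
proof -
  interpret measured_pseudo_bck_algebra le limp rimp one m
    using assms(1,4)
    by (simp add: measured_pseudo_bck_algebra_def measured_pseudo_bck_algebra_axioms_def)
  show ?thesis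
    using maximal_filter_Ker0[OF _ assms(5)] measure_join_eq_min assms(3)
    unfolding measure_morphism_iff downwards_directed_def by metis
qed

end
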